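(* Let $N\ge 2$ be even, let $N_c\ge 1$, and let $n_1,\dots,n_{N_c}\ge 1$ be integers with $\sum_{\alpha=1}^{N_c}2n_\alpha=N$. Put $f_\alpha=n_\alpha/N$. Let $\Delta\in[0,\pi]$ and $\omega_0\ge 0$. For the bimodal Kuramoto model with confidence bound $\Delta$ and natural frequencies $\pm\omega_0$, the point $(\Delta,\omega_0)$ belongs to the domain of existence of the partition $\{n_1,\dots,n_{N_c}\}$ if and only if both of the following conditions hold: $$\omega_0\le\begin{cases}\min_\alpha [f_\alpha]\,\sin(\Delta), & \Delta\le \pi/2,\\ \min_\alpha [f_\alpha], & \Delta>\pi/2,\end{cases}$$ and $$\frac{1}{N_c}\Big(2\pi-\sum_{\alpha=1}^{N_c}\arcsin(\omega_0/f_\alpha)\Big)>\Delta .$$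
   Context: Model: $N$ (even) oscillators with phases $\theta_i\in\mathbb S^1$ evolve by $\dot\theta_i=\omega_i-\frac1N\sum_{j=1}^N a_{ij}\sin(\theta_i-\theta_j)$, where $a_{ij}=1$ if $\|\theta_i-\theta_j\|\le\Delta$ and $a_{ij}=0$ otherwise. Here $\|\cdot\|$ is the geodesic distance on $\mathbb S^1$ (circle of length $2\pi$). The index set is partitioned into $\bm I_+$ and $\bm I_-$ of equal cardinality $N/2$, with $\omega_i=\omega_0$ for $i\in\bm I_+$ and $\omega_i=-\omega_0$ for $i\in\bm I_-$. A fixed point is a phase configuration with $\dot\theta_i=0$ for all $i$. A cluster of a fixed point is a connected component of the graph with adjacency matrix $(a_{ij})$ evaluated at that fixed point. Every cluster is taken to have an even number $2n$ of oscillators, $n$ from $\bm I_+$ and $n$ from $\bm I_-$. A cluster is all-to-all if $a_{ij}=1$ for all $i,j$ in it. It is in the 2-group configuration if all its oscillators from $\bm I_+$ have a common phase $\theta_+$ and all its oscillators from $\bm I_-$ have a common phase $\theta_-$. Domain of existence of a partition $\{n_1,\dots,n_{N_c}\}$ (with $\sum_\alpha 2n_\alpha=N$): the set of $(\Delta,\omega_0)\in[0,\pi]\times[0,\infty)$ for which there is a fixed point consisting of exactly $N_c$ clusters $\Lambda_1,\dots,\Lambda_{N_c}$, where $\Lambda_\alpha$ has $2n_\alpha$ oscillators ($n_\alpha$ from each of $\bm I_+,\bm I_-$), is all-to-all and in the 2-group configuration with phases $\theta_{\alpha,+},\theta_{\alpha,-}$ satisfying the stability restriction $\|\theta_{\alpha,+}-\theta_{\alpha,-}\|\le\pi/2$.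 *)

theory Defs
  imports Complex_Main "HOL-Library.Real_Mod"
begin

text \<open>
  Phases are real lifts of points of the circle of length \<^term>\<open>2 * pi\<close>; two lifts
  \<open>x\<close>, \<open>y\<close> are the same phase iff \<^term>\<open>[x = y] (rmod (2 * pi))\<close>.
  The geodesic distance is the quotient metric, i.e. the least distance between lifts.
  Configurations \<open>\<theta> :: nat \<Rightarrow> real\<close> are only ever evaluated on the
  oscillators \<open>{1..N}\<close>.
\<close>

definition circle_dist :: "real \<Rightarrow> real \<Rightarrow> real" where
  "circle_dist x y = (INF k::int. \<bar>x - y + 2 * pi * of_int k\<bar>)"

definition adj :: "real \<Rightarrow> (nat \<Rightarrow> real) \<Rightarrow> nat \<Rightarrow> nat \<Rightarrow> real" where
  "adj \<Delta> \<theta> i j = (if circle_dist (\<theta> i) (\<theta> j) \<le> \<Delta> then 1 else 0)"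

definition bimodal_freq :: "nat set \<Rightarrow> real \<Rightarrow> nat \<Rightarrow> real" where
  "bimodal_freq Iplus \<omega>0 i = (if i \<in> Iplus then \<omega>0 else - \<omega>0)"

definition phase_velocity ::
  "nat \<Rightarrow> real \<Rightarrow> (nat \<Rightarrow> real) \<Rightarrow> (nat \<Rightarrow> real) \<Rightarrow> nat \<Rightarrow> real" where
  "phase_velocity N \<Delta> \<omega> \<theta> i =
     \<omega> i - 1 / real N * (\<Sum>j=1..N. adj \<Delta> \<theta> i j * sin (\<theta> i - \<theta> j))"

definition fixed_point ::
  "nat \<Rightarrow> real \<Rightarrow> (nat \<Rightarrow> real) \<Rightarrow> (nat \<Rightarrow> real) \<Rightarrow> bool" where
  "fixed_point N \<Delta> \<omega> \<theta> \<longleftrightarrow> (\<forall>i\<in>{1..N}. phase_velocity N \<Delta> \<omega> \<theta> i = 0)"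

text \<open>
  Since \<^const>\<open>adj\<close> is symmetric, the equivalence classes of reachability along \<open>edges\<close>
  are the connected components of the graph.
\<close>

definition edges :: "nat \<Rightarrow> real \<Rightarrow> (nat \<Rightarrow> real) \<Rightarrow> (nat \<times> nat) set" where
  "edges N \<Delta> \<theta> = {(i, j) \<in> {1..N} \<times> {1..N}. adj \<Delta> \<theta> i j = 1}"

definition clusters :: "nat \<Rightarrow> real \<Rightarrow> (nat \<Rightarrow> real) \<Rightarrow> nat set set" where
  "clusters N \<Delta> \<theta> = {1..N} // ((edges N \<Delta> \<theta>)\<^sup>* \<inter> {1..N} \<times> {1..N})"

definition all_to_all :: "real \<Rightarrow> (nat \<Rightarrow> real) \<Rightarrow> nat set \<Rightarrow> bool" where
  "all_to_all \<Delta> \<theta> C \<longleftrightarrow> (\<forall>i\<in>C. \<forall>j\<in>C. adj \<Delta> \<theta> i j = 1)"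

definition two_group ::
  "nat set \<Rightarrow> nat set \<Rightarrow> (nat \<Rightarrow> real) \<Rightarrow> nat set \<Rightarrow> real \<Rightarrow> real \<Rightarrow> bool" where
  "two_group Iplus Iminus \<theta> C \<theta>p \<theta>m \<longleftrightarrow>
     (\<forall>i\<in>C \<inter> Iplus. [\<theta> i = \<theta>p] (rmod (2 * pi))) \<and>
     (\<forall>i\<in>C \<inter> Iminus. [\<theta> i = \<theta>m] (rmod (2 * pi)))"

definition existence_domain ::
  "nat \<Rightarrow> nat set \<Rightarrow> nat set \<Rightarrow> nat \<Rightarrow> (nat \<Rightarrow> nat) \<Rightarrow> (real \<times> real) set" where
  "existence_domain N Iplus Iminus Nc n =
     {(\<Delta>, \<omega>0) \<in> {0..pi} \<times> {0..}.
        \<exists>\<theta> \<Lambda>. fixed_point N \<Delta> (bimodal_freq Iplus \<omega>0) \<theta> \<and>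
          bij_betw \<Lambda> {1..Nc} (clusters N \<Delta> \<theta>) \<and>
          (\<forall>\<alpha>\<in>{1..Nc}.
             card (\<Lambda> \<alpha>) = 2 * n \<alpha> \<and>
             card (\<Lambda> \<alpha> \<inter> Iplus) = n \<alpha> \<and>
             card (\<Lambda> \<alpha> \<inter> Iminus) = n \<alpha> \<and>
             all_to_all \<Delta> \<theta> (\<Lambda> \<alpha>) \<and>
             (\<exists>\<theta>p \<theta>m. two_group Iplus Iminus \<theta> (\<Lambda> \<alpha>) \<theta>p \<theta>m \<and>
                circle_dist \<theta>p \<theta>m \<le> pi / 2))}"

end

theory Submission
  imports Defs
begin

text \<open>
  In a fixed point each cluster occupies an arc running counterclockwise from its \<open>Iminus\<close>
  phase to its \<open>Iplus\<close> phase, and the fixed-point equation together with the stability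
  restriction forces the length of the arc to be \<open>arcsin (\<omega>0 / f \<alpha>)\<close>. All-to-all coupling means
  that this length is at most \<open>\<Delta>\<close>, which is the first condition. Distinct clusters are more than
  \<open>\<Delta>\<close> apart, so the \<open>Nc\<close> gaps between cyclically consecutive arcs all exceed \<open>\<Delta>\<close>; since arcs
  and gaps fill the circle, this is the second condition. Conversely, if both conditions hold,
  arcs of these lengths are placed on the circle with \<open>Nc\<close> equal gaps.
\<close>

section \<open>Geodesic distance on the circle\<close>

lemma rcong_2piE:
  assumes "[x = y] (rmod (2 * pi))"
  obtains k :: int where "x = y + 2 * pi * of_int k"
  using assms[THEN rcong_sym] by (auto simp: rcong_altdef mult_ac)

lemma circle_dist_le: "circle_dist x y \<le> \<bar>x - y + 2 * pi * of_int k\<bar>"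
  unfolding circle_dist_def by (rule cINF_lower) (auto intro!: bdd_belowI[of _ 0])

text \<open>Two distinct lifts of the difference are at least one full turn apart, so a lift of
  modulus at most \<pi> cannot be beaten by another one.\<close>

lemma circle_dist_eq:
  assumes "\<bar>x - y + 2 * pi * of_int k\<bar> \<le> pi"
  shows "circle_dist x y = \<bar>x - y + 2 * pi * of_int k\<bar>"
proof (rule antisym[OF circle_dist_le])
  have "\<bar>x - y + 2 * pi * of_int k\<bar> \<le> \<bar>x - y + 2 * pi * of_int l\<bar>" for l :: int
  proof (cases "l = k")
    case False
    then have "1 \<le> \<bar>real_of_int (l - k)\<bar>" by linarith
    then have "2 * pi * 1 \<le> 2 * pi * \<bar>real_of_int (l - k)\<bar>"
      by (intro mult_left_mono) auto
    also have "\<dots> = \<bar>2 * pi * of_int l - 2 * pi * of_int k\<bar>"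
      by (simp add: abs_mult flip: right_diff_distrib)
    finally show ?thesis using assms by linarith
  qed simp
  then show "\<bar>x - y + 2 * pi * of_int k\<bar> \<le> circle_dist x y"
    unfolding circle_dist_def by (intro cINF_greatest) auto
qed

text \<open>Rounding the difference, measured in turns, to the nearest integer leaves at most half a
  turn. The infimum is therefore a minimum, and later arguments can pick a concrete lift.\<close>

lemma circle_dist_attained:
  obtains k :: int where "circle_dist x y = \<bar>x - y + 2 * pi * of_int k\<bar>"
proof -
  define t where "t = (y - x) / (2 * pi)"
  have t: "x - y = - (2 * pi * t)" by (simp add: t_def)
  have "\<bar>of_int (round t) - t\<bar> \<le> 1 / 2" by (rule of_int_round_abs_le)
  then have "2 * pi * \<bar>of_int (round t) - t\<bar> \<le> 2 * pi * (1 / 2)"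
    by (intro mult_left_mono) auto
  then have "\<bar>x - y + 2 * pi * of_int (round t)\<bar> \<le> pi"
    using abs_mult[of "2 * pi" "of_int (round t) - t"] by (simp add: t right_diff_distrib)
  from circle_dist_eq[OF this] show ?thesis by (rule that)
qed

lemma circle_dist_shift: "circle_dist (x + 2 * pi * of_int k) (y + 2 * pi * of_int l) = circle_dist x y"
proof (rule antisym)
  obtain i where "circle_dist x y = \<bar>x - y + 2 * pi * of_int i\<bar>" by (rule circle_dist_attained)
  then show "circle_dist (x + 2 * pi * of_int k) (y + 2 * pi * of_int l) \<le> circle_dist x y"
    using circle_dist_le[of "x + 2 * pi * of_int k" "y + 2 * pi * of_int l" "i - k + l"]
    by (simp add: algebra_simps)
next
  obtain i where "circle_dist (x + 2 * pi * of_int k) (y + 2 * pi * of_int l) =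
      \<bar>x + 2 * pi * of_int k - (y + 2 * pi * of_int l) + 2 * pi * of_int i\<bar>"
    by (rule circle_dist_attained)
  then show "circle_dist x y \<le> circle_dist (x + 2 * pi * of_int k) (y + 2 * pi * of_int l)"
    using circle_dist_le[of x y "i + k - l"] by (simp add: algebra_simps)
qed

lemma circle_dist_cong:
  assumes "[x = x'] (rmod (2 * pi))" "[y = y'] (rmod (2 * pi))"
  shows "circle_dist x y = circle_dist x' y'"
proof -
  obtain k l :: int where "x = x' + 2 * pi * of_int k" "y = y' + 2 * pi * of_int l"
    by (metis assms rcong_2piE)
  then show ?thesis using circle_dist_shift by simp
qed

lemma circle_dist_commute: "circle_dist x y = circle_dist y x"
proof -
  have "circle_dist x y \<le> circle_dist y x" for x y
  proof -
    obtain i where "circle_dist y x = \<bar>y - x + 2 * pi * of_int i\<bar>" by (rule circle_dist_attained)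
    then show ?thesis using circle_dist_le[of x y "- i"] by simp
  qed
  then show ?thesis by (meson antisym)
qed

text \<open>The two hypotheses bound the two ways round the circle. Shifts with
  \<open>k \<le> 0\<close> keep the signed difference at or below \<open>-g\<close>, and shifts with
  \<open>k \<ge> 1\<close> move it to at least \<open>g\<close>.\<close>

lemma circle_dist_ge:
  assumes "g \<le> y - x" "y - x \<le> 2 * pi - g"
  shows "g \<le> circle_dist x y"
proof -
  obtain k where k: "circle_dist x y = \<bar>x - y + 2 * pi * of_int k\<bar>" by (rule circle_dist_attained)
  show ?thesis
  proof (cases "k \<le> 0")
    case True
    then have "2 * pi * of_int k \<le> 0" by (simp add: mult_nonneg_nonpos)
    then show ?thesis unfolding k using assms by linarith
  next
    case False
    then have "2 * pi * 1 \<le> 2 * pi * of_int k" by (intro mult_left_mono) auto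
    then show ?thesis unfolding k using assms by linarith
  qed
qed

section \<open>Coupling sums in the 2-group configuration\<close>

lemma sin_diff_cong:
  assumes "[x = x'] (rmod (2 * pi))" "[y = y'] (rmod (2 * pi))"
  shows "sin (x - y) = sin (x' - y')"
  using assms by (intro sin_rcong rcong_diff)

text \<open>Members of the oscillator's own group contribute sin 0, and all members of the other
  group contribute the same value, with a sign depending on the group of \<open>i\<close>. So only
  the size of the opposite group enters.\<close>

lemma coupling_two_group:
  assumes C: "C \<subseteq> {1..N}" "C \<subseteq> Iplus \<union> Iminus" "Iplus \<inter> Iminus = {}" and i: "i \<in> C"
    and adj: "\<And>j. j \<in> {1..N} \<Longrightarrow> adj \<Delta> \<theta> i j = (if j \<in> C then 1 else 0)"
    and grp: "two_group Iplus Iminus \<theta> C \<theta>p \<theta>m"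
  shows "(\<Sum>j=1..N. adj \<Delta> \<theta> i j * sin (\<theta> i - \<theta> j)) =
    (if i \<in> Iplus then real (card (C \<inter> Iminus)) * sin (\<theta>p - \<theta>m)
     else - real (card (C \<inter> Iplus)) * sin (\<theta>p - \<theta>m))"
proof -
  have fin: "finite C" using C(1) by (rule finite_subset) auto
  have plus: "\<And>j. j \<in> C \<inter> Iplus \<Longrightarrow> [\<theta> j = \<theta>p] (rmod (2 * pi))"
    and minus: "\<And>j. j \<in> C \<inter> Iminus \<Longrightarrow> [\<theta> j = \<theta>m] (rmod (2 * pi))"
    using grp by (auto simp: two_group_def)
  have "(\<Sum>j=1..N. adj \<Delta> \<theta> i j * sin (\<theta> i - \<theta> j)) = (\<Sum>j\<in>C. sin (\<theta> i - \<theta> j))"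
    using C(1) adj by (intro sum.mono_neutral_cong_right) auto
  also have "C = (C \<inter> Iplus) \<union> (C \<inter> Iminus)" using C(2) by auto
  also have "(\<Sum>j\<in>\<dots>. sin (\<theta> i - \<theta> j)) =
      (\<Sum>j\<in>C \<inter> Iplus. sin (\<theta> i - \<theta> j)) + (\<Sum>j\<in>C \<inter> Iminus. sin (\<theta> i - \<theta> j))"
    using fin C(3) by (intro sum.union_disjoint) auto
  also have "\<dots> = (if i \<in> Iplus then real (card (C \<inter> Iminus)) * sin (\<theta>p - \<theta>m)
     else - real (card (C \<inter> Iplus)) * sin (\<theta>p - \<theta>m))"
  proof (cases "i \<in> Iplus")
    case True
    with i have "[\<theta> i = \<theta>p] (rmod (2 * pi))" by (intro plus) auto
    then have "\<And>j. j \<in> C \<inter> Iplus \<Longrightarrow> sin (\<theta> i - \<theta> j) = 0"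
      "\<And>j. j \<in> C \<inter> Iminus \<Longrightarrow> sin (\<theta> i - \<theta> j) = sin (\<theta>p - \<theta>m)"
      using sin_diff_cong plus minus by (metis cancel_comm_monoid_add_class.diff_cancel sin_zero, blast)
    then show ?thesis using True by simp
  next
    case False
    with i C(2) have "[\<theta> i = \<theta>m] (rmod (2 * pi))" by (intro minus) auto
    then have "\<And>j. j \<in> C \<inter> Iminus \<Longrightarrow> sin (\<theta> i - \<theta> j) = 0"
      "\<And>j. j \<in> C \<inter> Iplus \<Longrightarrow> sin (\<theta> i - \<theta> j) = - sin (\<theta>p - \<theta>m)"
      using sin_diff_cong plus minus
      by (metis cancel_comm_monoid_add_class.diff_cancel sin_zero, metis minus_diff_eq sin_minus)
    then show ?thesis using False by simp
  qed
  finally show ?thesis .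
qed

section \<open>Clusters as equivalence classes\<close>

lemma equiv_connected: "equiv {1..N} ((edges N \<Delta> \<theta>)\<^sup>* \<inter> {1..N} \<times> {1..N})"
proof (rule equivI)
  have "sym (edges N \<Delta> \<theta>)"
    by (auto simp: sym_def edges_def adj_def circle_dist_commute)
  then have "sym ((edges N \<Delta> \<theta>)\<^sup>*)" by (rule sym_rtrancl)
  then show "sym ((edges N \<Delta> \<theta>)\<^sup>* \<inter> {1..N} \<times> {1..N})" by (auto simp: sym_def)
  show "trans ((edges N \<Delta> \<theta>)\<^sup>* \<inter> {1..N} \<times> {1..N})"
    by (auto intro!: transI intro: rtrancl_trans)
qed (auto simp: refl_on_def)

lemma clusters_subset: "C \<in> clusters N \<Delta> \<theta> \<Longrightarrow> C \<subseteq> {1..N}"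
  unfolding clusters_def by (auto elim!: quotientE)

text \<open>A single edge is already a path. Used in contrapositive form: oscillators in different
  clusters are more than \<Delta> apart.\<close>

lemma adjacent_imp_same_cluster:
  assumes "C \<in> clusters N \<Delta> \<theta>" "D \<in> clusters N \<Delta> \<theta>" "i \<in> C" "j \<in> D" "adj \<Delta> \<theta> i j = 1"
  shows "C = D"
proof (rule quotient_eqI[OF equiv_connected assms(1,2)[unfolded clusters_def] assms(3,4)])
  have "(i, j) \<in> edges N \<Delta> \<theta>"
    using assms clusters_subset by (fastforce simp: edges_def)
  then show "(i, j) \<in> (edges N \<Delta> \<theta>)\<^sup>* \<inter> {1..N} \<times> {1..N}" by (auto simp: edges_def)
qed

text \<open>If adjacency means equality of colours, the edge relation is transitive. Its closure
  then adds only diagonal pairs, and those inside \<open>{1..N}\<close> are edges already, so the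
  components are the colour classes.\<close>

lemma clusters_colouring:
  assumes adj: "\<And>i j. i \<in> {1..N} \<Longrightarrow> j \<in> {1..N} \<Longrightarrow> adj \<Delta> \<theta> i j = 1 \<longleftrightarrow> c i = c j"
  shows "clusters N \<Delta> \<theta> = (\<lambda>i. {j\<in>{1..N}. c j = c i}) ` {1..N}"
proof -
  have E: "edges N \<Delta> \<theta> = {(i, j). i \<in> {1..N} \<and> j \<in> {1..N} \<and> c i = c j}"
    using adj unfolding edges_def by blast
  then have "trans (edges N \<Delta> \<theta>)" by (simp add: trans_def)
  then have "(edges N \<Delta> \<theta>)\<^sup>* = (edges N \<Delta> \<theta>)\<^sup>="
    by (metis rtrancl_trancl_reflcl trancl_id)
  then have "(edges N \<Delta> \<theta>)\<^sup>* \<inter> {1..N} \<times> {1..N} = edges N \<Delta> \<theta>"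
    unfolding E by blast
  moreover have "edges N \<Delta> \<theta> `` {i} = {j\<in>{1..N}. c j = c i}" if "i \<in> {1..N}" for i
    unfolding E using that by auto
  ultimately show ?thesis
    unfolding clusters_def quotient_def by auto
qed

section \<open>Packing separated arcs on the circle\<close>

text \<open>Induction in increasing order of left end points: the last interval is removed, and its
  left end point becomes the new right bound for the others. This is why \<open>y\<close> is
  generalised.\<close>

lemma disjoint_intervals_sum_less:
  fixes a l :: "'a \<Rightarrow> real"
  assumes "finite S" and "S \<noteq> {}"
    and "\<And>\<alpha>. \<alpha> \<in> S \<Longrightarrow> x \<le> a \<alpha>" and "\<And>\<alpha>. \<alpha> \<in> S \<Longrightarrow> a \<alpha> + l \<alpha> < y"
    and "inj_on a S"
    and "\<And>\<alpha> \<beta>. \<alpha> \<in> S \<Longrightarrow> \<beta> \<in> S \<Longrightarrow> a \<alpha> < a \<beta> \<Longrightarrow> a \<alpha> + l \<alpha> < a \<beta>"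
  shows "(\<Sum>\<alpha>\<in>S. l \<alpha>) < y - x"
  using assms
proof (induction arbitrary: y rule: finite_ranking_induct[where f = a])
  case empty
  then show ?case by simp
next
  case (insert \<beta> S)
  show ?case
  \<comment> \<open>The ranking induction does not guarantee that the inserted element is
    new.\<close>
  proof (cases "\<beta> \<in> S")
    case True
    then have "insert \<beta> S = S" by auto
    then show ?thesis using insert by (metis emptyE)
  next
    case False
    \<comment> \<open>Only the weak inequality is available here, since \<open>S\<close> may be
      empty and \<open>a \<beta> = x\<close>; strictness comes from the last interval ending before
      \<open>y\<close>.\<close>
    have "(\<Sum>\<alpha>\<in>S. l \<alpha>) \<le> a \<beta> - x"
    proof (cases "S = {}")
      case True
      then show ?thesis using insert.prems by auto
    next
      case nonempty: False
      have "a \<alpha> + l \<alpha> < a \<beta>" if "\<alpha> \<in> S" for \<alpha>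
      proof -
        have "a \<alpha> \<noteq> a \<beta>" using insert.prems(4) False that by (auto simp: inj_on_def)
        then show ?thesis using insert.hyps(2)[OF that] that insert.prems(5)[of \<alpha> \<beta>] by auto
      qed
      then have "(\<Sum>\<alpha>\<in>S. l \<alpha>) < a \<beta> - x"
        using insert.prems nonempty by (intro insert.IH) auto
      then show ?thesis by simp
    qed
    moreover have "a \<beta> + l \<beta> < y" using insert.prems by auto
    ultimately show ?thesis using False insert.hyps(1) by simp
  qed
qed

lemma lift_to_window:
  fixes x z :: real
  obtains k :: int where "z \<le> x + 2 * pi * of_int k" "x + 2 * pi * of_int k < z + 2 * pi"
proof -
  define t where "t = (z - x) / (2 * pi)"
  have t: "z - x = 2 * pi * t" by (simp add: t_def)
  have "t \<le> of_int \<lceil>t\<rceil>" "of_int \<lceil>t\<rceil> < t + 1" by linarith+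
  then have "2 * pi * t \<le> 2 * pi * of_int \<lceil>t\<rceil>" "2 * pi * of_int \<lceil>t\<rceil> < 2 * pi * (t + 1)"
    by (intro mult_left_mono mult_strict_left_mono; simp)+
  with t that[of "\<lceil>t\<rceil>"] show ?thesis by (simp add: algebra_simps)
qed

lemma separated_arcs_sum_less:
  fixes m s :: "'a \<Rightarrow> real"
  assumes "finite S" and "S \<noteq> {}"
    and s: "\<And>\<alpha>. \<alpha> \<in> S \<Longrightarrow> s \<alpha> \<le> \<Delta>" "\<And>\<alpha>. \<alpha> \<in> S \<Longrightarrow> s \<alpha> + \<Delta> < 2 * pi"
    and sep: "\<And>\<alpha> \<beta>. \<alpha> \<in> S \<Longrightarrow> \<beta> \<in> S \<Longrightarrow> \<alpha> \<noteq> \<beta> \<Longrightarrow> \<Delta> < circle_dist (m \<beta>) (m \<alpha> + s \<alpha>)"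
      "\<And>\<alpha> \<beta>. \<alpha> \<in> S \<Longrightarrow> \<beta> \<in> S \<Longrightarrow> \<alpha> \<noteq> \<beta> \<Longrightarrow> 0 < circle_dist (m \<beta>) (m \<alpha>)"
  shows "(\<Sum>\<alpha>\<in>S. s \<alpha> + \<Delta>) < 2 * pi"
  \<comment> \<open>Cut the circle at the start of one arc. As no arc is longer than \<open>\<Delta>\<close>, the separation of
    starting points from end points then already fixes the order of the lifted arcs on the line.\<close>
proof -
  obtain \<alpha>0 where \<alpha>0: "\<alpha>0 \<in> S" using \<open>S \<noteq> {}\<close> by auto
  define z where "z = m \<alpha>0"
  have "\<forall>\<alpha>. \<exists>k::int. z \<le> m \<alpha> + 2 * pi * of_int k \<and> m \<alpha> + 2 * pi * of_int k < z + 2 * pi"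
    using lift_to_window by metis
  then obtain k :: "'a \<Rightarrow> int" where
    k: "\<And>\<alpha>. z \<le> m \<alpha> + 2 * pi * of_int (k \<alpha>)" "\<And>\<alpha>. m \<alpha> + 2 * pi * of_int (k \<alpha>) < z + 2 * pi"
    by metis
  define a where "a \<alpha> = m \<alpha> + 2 * pi * of_int (k \<alpha>)" for \<alpha>
  have a: "z \<le> a \<alpha>" "a \<alpha> < z + 2 * pi" for \<alpha> using k by (simp_all add: a_def)
  \<comment> \<open>The separation holds for every lift: \<open>l = 0\<close> compares arcs within
    the window, \<open>l = 1\<close> compares an arc with a start one turn later.\<close>
  have gap: "\<Delta> < \<bar>a \<beta> - a \<alpha> - s \<alpha> + 2 * pi * of_int l\<bar>"
    if "\<alpha> \<in> S" "\<beta> \<in> S" "\<alpha> \<noteq> \<beta>" for \<alpha> \<beta> and l :: int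
    using sep(1)[OF that] circle_dist_le[of "m \<beta>" "m \<alpha> + s \<alpha>" "k \<beta> - k \<alpha> + l"]
    by (simp add: a_def algebra_simps)
  have inj: "inj_on a S"
  proof (rule inj_onI, rule ccontr)
    fix \<alpha> \<beta> assume *: "\<alpha> \<in> S" "\<beta> \<in> S" "a \<alpha> = a \<beta>" "\<alpha> \<noteq> \<beta>"
    then show False
      using sep(2)[of \<alpha> \<beta>] circle_dist_le[of "m \<beta>" "m \<alpha>" "k \<beta> - k \<alpha>"]
      by (simp add: a_def algebra_simps)
  qed
  have "a \<alpha>0 = z"
  proof -
    have "2 * pi * of_int (k \<alpha>0) < 2 * pi * 1" "2 * pi * 0 \<le> 2 * pi * of_int (k \<alpha>0)"
      using k[of \<alpha>0] by (simp_all add: z_def)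
    then have "k \<alpha>0 = 0" using pi_gt_zero by (simp add: zero_le_mult_iff)
    then show ?thesis by (simp add: a_def z_def)
  qed
  have "(\<Sum>\<alpha>\<in>S. s \<alpha> + \<Delta>) < (z + 2 * pi) - z"
  proof (rule disjoint_intervals_sum_less[OF assms(1,2) a(1) _ inj])
    fix \<alpha> assume \<alpha>: "\<alpha> \<in> S"
    show "a \<alpha> + (s \<alpha> + \<Delta>) < z + 2 * pi"
    proof (cases "\<alpha> = \<alpha>0")
      case True
      \<comment> \<open>Separation concerns distinct arcs only. That the first arc does not come
        within \<Delta> of its own start after one turn is the separate hypothesis
        \<open>s \<alpha> + \<Delta> < 2 * pi\<close>.\<close>
      then show ?thesis using s(2)[OF \<alpha>] \<open>a \<alpha>0 = z\<close> by simp
    next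
      case False
      \<comment> \<open>The next copy of the first arc starts at \<open>z + 2 * pi\<close>. The end
        of arc \<alpha> cannot lie more than \<Delta> beyond that point, because
        \<open>a \<alpha> < z + 2 * pi\<close> and \<open>s \<alpha> \<le> \<Delta>\<close>; hence
        it lies more than \<Delta> before it.\<close>
      then show ?thesis
        using gap[OF \<alpha> \<alpha>0, of 1] s(1)[OF \<alpha>] a(2)[of \<alpha>] \<open>a \<alpha>0 = z\<close> by simp
    qed
  next
    fix \<alpha> \<beta> assume *: "\<alpha> \<in> S" "\<beta> \<in> S" "a \<alpha> < a \<beta>"
    then show "a \<alpha> + (s \<alpha> + \<Delta>) < a \<beta>"
      using gap[of \<alpha> \<beta> 0] s(1)[of \<alpha>] by fastforce
  qed
  then show ?thesis by simp
qed

section \<open>Distribution of oscillators and the capped sine bound\<close>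

text \<open>Induction on the colours: set aside \<open>n \<beta>\<close> elements for the new colour
  and colour the rest. It later assigns the oscillators of each group to clusters.\<close>

lemma exists_colouring:
  fixes n :: "'b \<Rightarrow> nat"
  assumes "finite S" "finite A" "card A = (\<Sum>\<alpha>\<in>S. n \<alpha>)"
  shows "\<exists>c. c ` A \<subseteq> S \<and> (\<forall>\<alpha>\<in>S. card {i\<in>A. c i = \<alpha>} = n \<alpha>)"
  using assms
proof (induction arbitrary: A rule: finite_induct)
  case empty
  then show ?case by auto
next
  case (insert \<beta> S)
  have card: "card A = n \<beta> + (\<Sum>\<alpha>\<in>S. n \<alpha>)"
    using insert.prems(2) insert.hyps by simp
  then have "n \<beta> \<le> card A" by simp
  then obtain B where B: "B \<subseteq> A" "card B = n \<beta>" by (rule obtain_subset_with_card_n)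
  have "card (A - B) = (\<Sum>\<alpha>\<in>S. n \<alpha>)"
    using card B insert.prems(1) by (simp add: card_Diff_subset finite_subset)
  then obtain c where c: "c ` (A - B) \<subseteq> S" "\<forall>\<alpha>\<in>S. card {i\<in>A - B. c i = \<alpha>} = n \<alpha>"
    using insert.IH[of "A - B"] insert.prems(1) by blast
  define d where "d i = (if i \<in> B then \<beta> else c i)" for i
  have "{i\<in>A. d i = \<beta>} = B" using B c insert.hyps by (auto simp: d_def)
  moreover have "{i\<in>A. d i = \<alpha>} = {i\<in>A - B. c i = \<alpha>}" if "\<alpha> \<in> S" for \<alpha>
    using B that insert.hyps by (auto simp: d_def)
  moreover have "d ` A \<subseteq> insert \<beta> S" using c by (auto simp: d_def)
  ultimately have "d ` A \<subseteq> insert \<beta> S \<and> (\<forall>\<alpha>\<in>insert \<beta> S. card {i\<in>A. d i = \<alpha>} = n \<alpha>)"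
    using B(2) c(2) by simp
  then show ?case by blast
qed

text \<open>Up to \<pi>/2 this is monotonicity of arcsin and sin; beyond, arcsin never exceeds
  \<pi>/2 < \<Delta>, so only \<open>r \<le> 1\<close> is left. It merges both cases of the
  frequency bound into one condition on the arc length. The conjunct \<open>r \<le> 1\<close> keeps
  the argument in the domain of arcsin.\<close>

lemma le_sin_capped_iff:
  fixes r \<Delta> :: real
  assumes "0 \<le> r" "0 \<le> \<Delta>"
  shows "r \<le> (if \<Delta> \<le> pi / 2 then sin \<Delta> else 1) \<longleftrightarrow> r \<le> 1 \<and> arcsin r \<le> \<Delta>"
proof (cases "\<Delta> \<le> pi / 2")
  case True
  have "arcsin r \<le> \<Delta> \<longleftrightarrow> r \<le> sin \<Delta>" if "r \<le> 1"
    using assms True that by (intro arcsin_le_iff) auto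
  moreover have "r \<le> 1" if "r \<le> sin \<Delta>" using that sin_le_one order_trans by blast
  ultimately show ?thesis using True by auto
next
  case False
  moreover have "arcsin r \<le> pi / 2" if "r \<le> 1" using assms that by (intro arcsin_ubound) auto
  ultimately show ?thesis using assms by fastforce
qed

section \<open>Necessity of the two conditions\<close>

text \<open>The equation of one \<open>Iplus\<close> oscillator reads \<omega>0 = (k/N)
  sin(\<theta>p - \<theta>m). The stability restriction selects the branch on which arcsin inverts
  the sine, and all-to-all coupling bounds the resulting lag by \<Delta>. The witnesses are an
  \<open>Iplus\<close> oscillator at the end of the arc and an \<open>Iminus\<close> oscillator at
  its start.\<close>

lemma cluster_phase_lag:
  assumes part: "Iplus \<union> Iminus = {1..N}" "Iplus \<inter> Iminus = {}"
    and fp: "fixed_point N \<Delta> (bimodal_freq Iplus \<omega>0) \<theta>"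
    and C: "C \<in> clusters N \<Delta> \<theta>"
    and card: "card (C \<inter> Iplus) = k" "card (C \<inter> Iminus) = k" "k \<ge> 1"
    and all: "all_to_all \<Delta> \<theta> C"
    and grp: "two_group Iplus Iminus \<theta> C \<theta>p \<theta>m" "circle_dist \<theta>p \<theta>m \<le> pi / 2"
    and r: "r = \<omega>0 / (real k / real N)"
  shows "r \<le> 1 \<and> arcsin r \<le> \<Delta> \<and>
    (\<exists>i\<in>C. \<exists>j\<in>C. [\<theta> i = \<theta> j + arcsin r] (rmod (2 * pi)))"
proof -
  have sub: "C \<subseteq> {1..N}" by (rule clusters_subset[OF C])
  have adj: "adj \<Delta> \<theta> i j = (if j \<in> C then 1 else 0)" if "i \<in> C" "j \<in> {1..N}" for i j
  proof (cases "j \<in> C")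
    case True
    then show ?thesis using all that by (simp add: all_to_all_def)
  next
    case outside: False
    obtain D where "D \<in> clusters N \<Delta> \<theta>" "j \<in> D"
      using Union_quotient[OF equiv_connected, of N \<Delta> \<theta>] \<open>j \<in> {1..N}\<close> unfolding clusters_def by blast
    then have "adj \<Delta> \<theta> i j \<noteq> 1"
      using adjacent_imp_same_cluster[OF C, of D i j] outside \<open>i \<in> C\<close> by blast
    then show ?thesis using outside by (simp add: adj_def split: if_splits)
  qed
  from card obtain i j where i: "i \<in> C" "i \<in> Iplus" and j: "j \<in> C" "j \<in> Iminus"
    by (metis IntE all_not_in_conv card.empty not_one_le_zero)
  have cong: "[\<theta> i = \<theta>p] (rmod (2 * pi))" "[\<theta> j = \<theta>m] (rmod (2 * pi))"
    using grp(1) i j by (auto simp: two_group_def)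
  have "i \<in> {1..N}" using i sub by auto
  then have N: "real N > 0" and "phase_velocity N \<Delta> (bimodal_freq Iplus \<omega>0) \<theta> i = 0"
    using fp by (auto simp: fixed_point_def)
  moreover have "(\<Sum>j=1..N. adj \<Delta> \<theta> i j * sin (\<theta> i - \<theta> j)) = real k * sin (\<theta>p - \<theta>m)"
    using coupling_two_group[OF sub _ part(2) i(1) adj[OF i(1)] grp(1)] sub part(1) i(2) card(2)
    by simp
  ultimately have "\<omega>0 = real k * sin (\<theta>p - \<theta>m) / real N"
    using i(2) by (simp add: phase_velocity_def bimodal_freq_def)
  then have r_sin: "r = sin (\<theta>p - \<theta>m)"
    unfolding r using N card(3) by simp
  \<comment> \<open>The lift realising the distance is chosen, so that the bounds \<pi>/2 and
    \<Delta> both apply to the signed difference \<open>d\<close>.\<close>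
  obtain l where l: "circle_dist (\<theta> i) (\<theta> j) = \<bar>\<theta> i - \<theta> j + 2 * pi * of_int l\<bar>"
    by (rule circle_dist_attained)
  define d where "d = \<theta> i - \<theta> j + 2 * pi * of_int l"
  have "\<bar>d\<bar> \<le> pi / 2"
    using grp(2) circle_dist_cong[OF cong] l by (simp add: d_def)
  moreover have cong_d: "[d = \<theta> i - \<theta> j] (rmod (2 * pi))"
    unfolding d_def by (rule rcong_sym) (auto simp: rcong_altdef mult_ac)
  then have "sin d = r"
    using sin_rcong sin_diff_cong[OF cong] r_sin by metis
  ultimately have d: "arcsin r = d" by (intro arcsin_unique) auto
  have "\<bar>d\<bar> \<le> \<Delta>"
    using adj[OF i(1), of j] j sub l by (auto simp: adj_def d_def split: if_splits)
  moreover have "[d + \<theta> j = (\<theta> i - \<theta> j) + \<theta> j] (rmod (2 * pi))"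
    using cong_d by (intro rcong_add) auto
  then have "[\<theta> i = \<theta> j + arcsin r] (rmod (2 * pi))"
    unfolding d by (simp add: rcong_sym add.commute)
  moreover have "r \<le> 1" using r_sin by simp
  ultimately show ?thesis using d i j by auto
qed

text \<open>The packing bound is applied to the arcs of the clusters, each represented by two actual
  oscillators: \<open>j \<alpha>\<close> at its start and \<open>i \<alpha>\<close> at its
  end.\<close>

lemma existence_domain_necessary:
  fixes N Nc :: nat and n :: "nat \<Rightarrow> nat"
  assumes part: "Iplus \<union> Iminus = {1..N}" "Iplus \<inter> Iminus = {}"
    and n: "\<And>\<alpha>. \<alpha> \<in> {1..Nc} \<Longrightarrow> n \<alpha> \<ge> 1"
    and f: "\<And>\<alpha>. \<alpha> \<in> {1..Nc} \<Longrightarrow> f \<alpha> = real (n \<alpha>) / real N"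
    and "Nc \<ge> 1" and dom: "(\<Delta>, \<omega>0) \<in> existence_domain N Iplus Iminus Nc n"
  shows "(\<forall>\<alpha>\<in>{1..Nc}. \<omega>0 / f \<alpha> \<le> 1 \<and> arcsin (\<omega>0 / f \<alpha>) \<le> \<Delta>) \<and>
    (\<Sum>\<alpha>=1..Nc. arcsin (\<omega>0 / f \<alpha>) + \<Delta>) < 2 * pi"
proof -
  define s where "s \<alpha> = arcsin (\<omega>0 / f \<alpha>)" for \<alpha>
  from dom obtain \<theta> \<Lambda> where \<Delta>: "0 \<le> \<Delta>" "\<Delta> \<le> pi" and \<omega>0: "0 \<le> \<omega>0"
    and fp: "fixed_point N \<Delta> (bimodal_freq Iplus \<omega>0) \<theta>"
    and bij: "bij_betw \<Lambda> {1..Nc} (clusters N \<Delta> \<theta>)"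
    and \<Lambda>: "\<And>\<alpha>. \<alpha> \<in> {1..Nc} \<Longrightarrow> card (\<Lambda> \<alpha> \<inter> Iplus) = n \<alpha> \<and> card (\<Lambda> \<alpha> \<inter> Iminus) = n \<alpha> \<and>
      all_to_all \<Delta> \<theta> (\<Lambda> \<alpha>) \<and>
      (\<exists>\<theta>p \<theta>m. two_group Iplus Iminus \<theta> (\<Lambda> \<alpha>) \<theta>p \<theta>m \<and> circle_dist \<theta>p \<theta>m \<le> pi / 2)"
    unfolding existence_domain_def by auto
  have cl: "\<Lambda> \<alpha> \<in> clusters N \<Delta> \<theta>" if "\<alpha> \<in> {1..Nc}" for \<alpha>
    using bij that by (rule bij_betw_apply)
  have lag: "\<omega>0 / f \<alpha> \<le> 1 \<and> s \<alpha> \<le> \<Delta> \<and>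
      (\<exists>i\<in>\<Lambda> \<alpha>. \<exists>j\<in>\<Lambda> \<alpha>. [\<theta> i = \<theta> j + s \<alpha>] (rmod (2 * pi)))" if "\<alpha> \<in> {1..Nc}" for \<alpha>
    using \<Lambda>[OF that] n[OF that] f[OF that] unfolding s_def
    by (elim conjE exE, intro cluster_phase_lag[OF part fp cl[OF that]]) auto
  then obtain i j where ij: "\<And>\<alpha>. \<alpha> \<in> {1..Nc} \<Longrightarrow>
      i \<alpha> \<in> \<Lambda> \<alpha> \<and> j \<alpha> \<in> \<Lambda> \<alpha> \<and> [\<theta> (i \<alpha>) = \<theta> (j \<alpha>) + s \<alpha>] (rmod (2 * pi))"
    by metis
  have far: "\<Delta> < circle_dist (\<theta> x) (\<theta> y)"
    if "\<alpha> \<in> {1..Nc}" "\<beta> \<in> {1..Nc}" "\<alpha> \<noteq> \<beta>" "x \<in> \<Lambda> \<beta>" "y \<in> \<Lambda> \<alpha>" for \<alpha> \<beta> x y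
  proof (rule ccontr)
    assume "\<not> ?thesis"
    then have "adj \<Delta> \<theta> x y = 1" by (simp add: adj_def)
    then have "\<Lambda> \<beta> = \<Lambda> \<alpha>" using that cl by (intro adjacent_imp_same_cluster)
    then show False using inj_onD[OF bij_betw_imp_inj_on[OF bij], of \<beta> \<alpha>] that(1-3) by simp
  qed
  have "(\<Sum>\<alpha>\<in>{1..Nc}. s \<alpha> + \<Delta>) < 2 * pi"
  proof (rule separated_arcs_sum_less[where m = "\<lambda>\<alpha>. \<theta> (j \<alpha>)"])
    fix \<alpha> assume \<alpha>: "\<alpha> \<in> {1..Nc}"
    then show "s \<alpha> \<le> \<Delta>" using lag by auto
    have "0 \<le> \<omega>0 / f \<alpha>" using \<omega>0 f[OF \<alpha>] by simp
    \<comment> \<open>An arc and a gap of length \<Delta> together measure at most 3\<pi>/2, less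
      than a full turn.\<close>
    then have "s \<alpha> \<le> pi / 2" unfolding s_def using lag[OF \<alpha>] by (intro arcsin_ubound) auto
    then show "s \<alpha> + \<Delta> < 2 * pi" using \<Delta> pi_gt_zero by linarith
  next
    fix \<alpha> \<beta> assume *: "\<alpha> \<in> {1..Nc}" "\<beta> \<in> {1..Nc}" "\<alpha> \<noteq> \<beta>"
    \<comment> \<open>The end of the arc is the phase of an oscillator, so the separation of
      clusters applies to it.\<close>
    have "circle_dist (\<theta> (j \<beta>)) (\<theta> (j \<alpha>) + s \<alpha>) = circle_dist (\<theta> (j \<beta>)) (\<theta> (i \<alpha>))"
      using ij[OF *(1)] by (intro circle_dist_cong rcong_refl) (auto intro: rcong_sym)
    then show "\<Delta> < circle_dist (\<theta> (j \<beta>)) (\<theta> (j \<alpha>) + s \<alpha>)"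
      using far[OF *] ij * by simp
    show "0 < circle_dist (\<theta> (j \<beta>)) (\<theta> (j \<alpha>))"
      using far[OF *, of "j \<beta>" "j \<alpha>"] ij * \<Delta>(1) by fastforce
  qed (use \<open>Nc \<ge> 1\<close> in auto)
  then show ?thesis using lag unfolding s_def by auto
qed

section \<open>Sufficiency: construction of a fixed point\<close>

text \<open>The arcs are laid out in the order of their indices along one turn starting at 0, each
  followed by a gap of the same length \<open>g\<close>. The fixed-point equations and the cluster
  structure are then verified directly.\<close>

lemma existence_domain_sufficient:
  fixes N Nc :: nat and n :: "nat \<Rightarrow> nat"
  assumes part: "Iplus \<union> Iminus = {1..N}" "Iplus \<inter> Iminus = {}"
    and n: "\<And>\<alpha>. \<alpha> \<in> {1..Nc} \<Longrightarrow> n \<alpha> \<ge> 1"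
    and f: "\<And>\<alpha>. \<alpha> \<in> {1..Nc} \<Longrightarrow> f \<alpha> = real (n \<alpha>) / real N"
    and "N > 0" "Nc \<ge> 1"
    and card: "card Iplus = (\<Sum>\<alpha>=1..Nc. n \<alpha>)" "card Iminus = (\<Sum>\<alpha>=1..Nc. n \<alpha>)"
    and \<Delta>: "\<Delta> \<in> {0..pi}" and \<omega>0: "\<omega>0 \<ge> 0"
    and lag: "\<And>\<alpha>. \<alpha> \<in> {1..Nc} \<Longrightarrow> \<omega>0 / f \<alpha> \<le> 1" "\<And>\<alpha>. \<alpha> \<in> {1..Nc} \<Longrightarrow> arcsin (\<omega>0 / f \<alpha>) \<le> \<Delta>"
    and sum: "(\<Sum>\<alpha>=1..Nc. arcsin (\<omega>0 / f \<alpha>) + \<Delta>) < 2 * pi"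
  shows "(\<Delta>, \<omega>0) \<in> existence_domain N Iplus Iminus Nc n"
proof -
  define s where "s \<alpha> = arcsin (\<omega>0 / f \<alpha>)" for \<alpha>
  \<comment> \<open>The part of the circle not covered by arcs, divided evenly; the second condition
    says exactly \<open>\<Delta> < g\<close>.\<close>
  define g where "g = (2 * pi - (\<Sum>\<alpha>=1..Nc. s \<alpha>)) / real Nc"
  have r: "0 \<le> \<omega>0 / f \<alpha>" if "\<alpha> \<in> {1..Nc}" for \<alpha> using f[OF that] \<omega>0 by simp
  have s: "0 \<le> s \<alpha>" "s \<alpha> \<le> pi / 2" "s \<alpha> \<le> \<Delta>" "sin (s \<alpha>) = \<omega>0 / f \<alpha>" if "\<alpha> \<in> {1..Nc}" for \<alpha>
    using r[OF that] lag[OF that] arcsin_ubound[of "\<omega>0 / f \<alpha>"] arcsin_nonneg[of "\<omega>0 / f \<alpha>"]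
    unfolding s_def by auto
  have g: "\<Delta> < g"
    using sum \<open>Nc \<ge> 1\<close> by (simp add: g_def s_def sum.distrib field_simps)
  have g_total: "(\<Sum>\<alpha>=1..Nc. s \<alpha> + g) = 2 * pi"
    using \<open>Nc \<ge> 1\<close> by (simp add: g_def sum.distrib)
  \<comment> \<open>Start of arc \<alpha>. The index \<open>Suc Nc\<close> stands for the first arc
    one turn later, which lets \<open>step\<close> cover the gap that closes the circle.\<close>
  define b where "b \<alpha> = (\<Sum>\<beta>=1..<\<alpha>. s \<beta> + g)" for \<alpha>
  have step: "b \<alpha> + s \<alpha> + g \<le> b \<beta>" if "\<alpha> \<in> {1..Nc}" "\<alpha> < \<beta>" "\<beta> \<le> Suc Nc" for \<alpha> \<beta>
  proof -
    have "b \<alpha> + s \<alpha> + g = (\<Sum>\<beta>=1..<Suc \<alpha>. s \<beta> + g)"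
      using that by (simp add: b_def)
    also have "\<dots> \<le> b \<beta>"
      unfolding b_def using that s(1) g \<Delta> by (intro sum_mono2) (auto intro!: add_nonneg_nonneg)
    finally show ?thesis .
  qed
  have b_nonneg: "0 \<le> b \<alpha>" if "\<alpha> \<in> {1..Nc}" for \<alpha>
    unfolding b_def using that s(1) g \<Delta> by (intro sum_nonneg) (auto intro!: add_nonneg_nonneg)
  have b_total: "b (Suc Nc) = 2 * pi"
    using g_total by (simp add: b_def atLeastLessThanSuc_atLeastAtMost)
  have fin: "finite Iplus" "finite Iminus"
    using part(1) by (metis finite_Un finite_atLeastAtMost)+
  \<comment> \<open>The two groups are coloured separately, so each cluster receives
    \<open>n \<alpha>\<close> oscillators from each.\<close>
  obtain cp where cp: "cp ` Iplus \<subseteq> {1..Nc}" "\<And>\<alpha>. \<alpha> \<in> {1..Nc} \<Longrightarrow> card {i\<in>Iplus. cp i = \<alpha>} = n \<alpha>"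
    using exists_colouring[OF _ fin(1) card(1)] by auto
  obtain cm where cm: "cm ` Iminus \<subseteq> {1..Nc}" "\<And>\<alpha>. \<alpha> \<in> {1..Nc} \<Longrightarrow> card {i\<in>Iminus. cm i = \<alpha>} = n \<alpha>"
    using exists_colouring[OF _ fin(2) card(2)] by auto
  define c where "c i = (if i \<in> Iplus then cp i else cm i)" for i
  define \<Lambda> where "\<Lambda> \<alpha> = {i\<in>{1..N}. c i = \<alpha>}" for \<alpha>
  \<comment> \<open>\<open>Iminus\<close> oscillators sit at the start of their arc,
    \<open>Iplus\<close> oscillators at its end.\<close>
  define \<theta> where "\<theta> i = b (c i) + (if i \<in> Iplus then s (c i) else 0)" for i
  have c_in: "c i \<in> {1..Nc}" if "i \<in> {1..N}" for i
  proof -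
    have "i \<in> Iplus \<or> i \<in> Iminus" using that part(1) by blast
    then show ?thesis using cp(1) cm(1) unfolding c_def by (auto simp: image_subset_iff)
  qed
  have "\<Lambda> \<alpha> \<inter> Iplus = {i\<in>Iplus. cp i = \<alpha>}" "\<Lambda> \<alpha> \<inter> Iminus = {i\<in>Iminus. cm i = \<alpha>}" for \<alpha>
    using part unfolding \<Lambda>_def c_def by auto
  then have card_\<Lambda>: "card (\<Lambda> \<alpha> \<inter> Iplus) = n \<alpha>" "card (\<Lambda> \<alpha> \<inter> Iminus) = n \<alpha>" if "\<alpha> \<in> {1..Nc}" for \<alpha>
    using cp(2) cm(2) that by auto
  have "\<Lambda> \<alpha> = (\<Lambda> \<alpha> \<inter> Iplus) \<union> (\<Lambda> \<alpha> \<inter> Iminus)" for \<alpha>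
    using part(1) unfolding \<Lambda>_def by blast
  then have card_\<Lambda>': "card (\<Lambda> \<alpha>) = 2 * n \<alpha>" if "\<alpha> \<in> {1..Nc}" for \<alpha>
    using card_Un_disjoint[of "\<Lambda> \<alpha> \<inter> Iplus" "\<Lambda> \<alpha> \<inter> Iminus"] card_\<Lambda>[OF that] fin part(2) by force
  have near: "circle_dist (\<theta> i) (\<theta> j) \<le> \<Delta>" if "i \<in> {1..N}" "j \<in> {1..N}" "c i = c j" for i j
  proof -
    have "\<bar>\<theta> i - \<theta> j + 2 * pi * of_int 0\<bar> \<le> s (c i)"
      using that s(1)[OF c_in[OF that(1)]] by (simp add: \<theta>_def)
    then show ?thesis using circle_dist_le[of "\<theta> i" "\<theta> j" 0] s(3)[OF c_in[OF that(1)]] by linarith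
  qed
  have far: "\<Delta> < circle_dist (\<theta> i) (\<theta> j)" if "i \<in> {1..N}" "j \<in> {1..N}" "c i < c j" for i j
  proof -
    note ci = c_in[OF that(1)] and cj = c_in[OF that(2)]
    have "g \<le> circle_dist (\<theta> i) (\<theta> j)"
    proof (rule circle_dist_ge)
      show "g \<le> \<theta> j - \<theta> i"
        using step[OF ci that(3)] cj s(1)[OF ci] s(1)[OF cj] by (auto simp: \<theta>_def)
      \<comment> \<open>The way round through 0: the gap after arc \<open>c j\<close> ends no later
        than 2\<pi>, and \<open>\<theta> i\<close> is nonnegative.\<close>
      show "\<theta> j - \<theta> i \<le> 2 * pi - g"
        using step[OF cj, of "Suc Nc"] cj b_total b_nonneg[OF ci] s(1)[OF ci] s(1)[OF cj]
        by (auto simp: \<theta>_def)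
    qed
    then show ?thesis using g by simp
  qed
  have adj: "adj \<Delta> \<theta> i j = 1 \<longleftrightarrow> c i = c j" if "i \<in> {1..N}" "j \<in> {1..N}" for i j
    using near[OF that] far[OF that] far[OF that(2,1)]
    by (cases "c i" "c j" rule: linorder_cases) (auto simp: adj_def circle_dist_commute)
  have c_surj: "c ` {1..N} = {1..Nc}"
  proof
    show "{1..Nc} \<subseteq> c ` {1..N}"
    proof
      fix \<alpha> assume "\<alpha> \<in> {1..Nc}"
      \<comment> \<open>Every colour occurs because \<open>n \<alpha> \<ge> 1\<close>; this also
        makes \<Lambda> injective below.\<close>
      then have "card (\<Lambda> \<alpha>) \<noteq> 0" using card_\<Lambda>' n by fastforce
      then show "\<alpha> \<in> c ` {1..N}" unfolding \<Lambda>_def by (auto simp: card_gt_0_iff)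
    qed
  qed (use c_in in auto)
  have "clusters N \<Delta> \<theta> = (\<lambda>i. \<Lambda> (c i)) ` {1..N}"
    unfolding \<Lambda>_def by (rule clusters_colouring) (rule adj)
  then have clusters: "clusters N \<Delta> \<theta> = \<Lambda> ` {1..Nc}"
    unfolding c_surj[symmetric] by (simp add: image_image)
  have "inj_on \<Lambda> {1..Nc}"
  proof (rule inj_onI)
    fix \<alpha> \<beta> assume "\<alpha> \<in> {1..Nc}" "\<Lambda> \<alpha> = \<Lambda> \<beta>"
    moreover from this(1) obtain i where "i \<in> {1..N}" "c i = \<alpha>"
      unfolding c_surj[symmetric] by blast
    ultimately show "\<alpha> = \<beta>" unfolding \<Lambda>_def by blast
  qed
  then have bij: "bij_betw \<Lambda> {1..Nc} (clusters N \<Delta> \<theta>)"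
    by (simp add: bij_betw_def clusters)
  have grp: "two_group Iplus Iminus \<theta> (\<Lambda> \<alpha>) (b \<alpha> + s \<alpha>) (b \<alpha>)" for \<alpha>
    using part(2) unfolding two_group_def \<Lambda>_def \<theta>_def by auto
  have dist: "circle_dist (b \<alpha> + s \<alpha>) (b \<alpha>) \<le> pi / 2" if "\<alpha> \<in> {1..Nc}" for \<alpha>
    using circle_dist_le[of "b \<alpha> + s \<alpha>" "b \<alpha>" 0] s(1,2)[OF that] by simp
  have all: "all_to_all \<Delta> \<theta> (\<Lambda> \<alpha>)" for \<alpha>
    using adj by (auto simp: all_to_all_def \<Lambda>_def)
  have "phase_velocity N \<Delta> (bimodal_freq Iplus \<omega>0) \<theta> i = 0" if i: "i \<in> {1..N}" for i
  proof -
    note ci = c_in[OF i]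
    have "adj \<Delta> \<theta> i j = (if j \<in> \<Lambda> (c i) then 1 else 0)" if "j \<in> {1..N}" for j
      using adj[OF i that] that by (auto simp: \<Lambda>_def adj_def split: if_splits)
    then have "(\<Sum>j=1..N. adj \<Delta> \<theta> i j * sin (\<theta> i - \<theta> j)) =
      (if i \<in> Iplus then real (card (\<Lambda> (c i) \<inter> Iminus)) * sin (b (c i) + s (c i) - b (c i))
       else - real (card (\<Lambda> (c i) \<inter> Iplus)) * sin (b (c i) + s (c i) - b (c i)))"
      using i part by (intro coupling_two_group grp) (auto simp: \<Lambda>_def)
    \<comment> \<open>The arc length was chosen so that f sin(s) = \<omega>0, that is n sin(s) = N
      \<omega>0; the sign agrees with that of the natural frequency.\<close>
    also have "\<dots> = (if i \<in> Iplus then 1 else - 1) * (real N * \<omega>0)"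
      using n[OF ci] by (simp add: card_\<Lambda>[OF ci] s(4)[OF ci] f[OF ci])
    finally show ?thesis
      using \<open>N > 0\<close> by (simp add: phase_velocity_def bimodal_freq_def)
  qed
  then have "fixed_point N \<Delta> (bimodal_freq Iplus \<omega>0) \<theta>" by (simp add: fixed_point_def)
  moreover have "\<forall>\<alpha>\<in>{1..Nc}. card (\<Lambda> \<alpha>) = 2 * n \<alpha> \<and> card (\<Lambda> \<alpha> \<inter> Iplus) = n \<alpha> \<and>
      card (\<Lambda> \<alpha> \<inter> Iminus) = n \<alpha> \<and> all_to_all \<Delta> \<theta> (\<Lambda> \<alpha>) \<and>
      (\<exists>\<theta>p \<theta>m. two_group Iplus Iminus \<theta> (\<Lambda> \<alpha>) \<theta>p \<theta>m \<and> circle_dist \<theta>p \<theta>m \<le> pi / 2)"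
    using card_\<Lambda> card_\<Lambda>' all grp dist by blast
  ultimately show ?thesis
    unfolding existence_domain_def using \<Delta> \<omega>0 bij by blast
qed

section \<open>Reduction of the stated inequalities to conditions on arc lengths\<close>

theorem mainTheorem1:
  fixes N Nc :: nat
    and n :: "nat \<Rightarrow> nat"
    and f :: "nat \<Rightarrow> real"
    and Iplus Iminus :: "nat set"
    and \<Delta> \<omega>0 :: real
  assumes "even N" and "N \<ge> 2"
    and "Iplus \<union> Iminus = {1..N}" and "Iplus \<inter> Iminus = {}"
    and "card Iplus = N div 2" and "card Iminus = N div 2"
    and "Nc \<ge> 1"
    and "\<And>\<alpha>. \<alpha> \<in> {1..Nc} \<Longrightarrow> n \<alpha> \<ge> 1"
    and "(\<Sum>\<alpha>=1..Nc. 2 * n \<alpha>) = N"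
    and "\<And>\<alpha>. \<alpha> \<in> {1..Nc} \<Longrightarrow> f \<alpha> = real (n \<alpha>) / real N"
    and "\<Delta> \<in> {0..pi}" and "\<omega>0 \<ge> 0"
  shows "(\<Delta>, \<omega>0) \<in> existence_domain N Iplus Iminus Nc n \<longleftrightarrow>
     \<omega>0 \<le> (if \<Delta> \<le> pi / 2 then (MIN \<alpha>\<in>{1..Nc}. f \<alpha>) * sin \<Delta>
             else (MIN \<alpha>\<in>{1..Nc}. f \<alpha>)) \<and>
     1 / real Nc * (2 * pi - (\<Sum>\<alpha>=1..Nc. arcsin (\<omega>0 / f \<alpha>))) > \<Delta>"
proof -
  have N: "real N > 0" using \<open>N \<ge> 2\<close> by simp
  have f_pos: "f \<alpha> > 0" if "\<alpha> \<in> {1..Nc}" for \<alpha>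
    using assms(8,10)[OF that] N by simp
  have "2 * (\<Sum>\<alpha>=1..Nc. n \<alpha>) = N" using assms(9) by (simp add: sum_distrib_left)
  then have card: "card Iplus = (\<Sum>\<alpha>=1..Nc. n \<alpha>)" "card Iminus = (\<Sum>\<alpha>=1..Nc. n \<alpha>)"
    using assms(5,6) by auto
  \<comment> \<open>A common nonnegative factor for both cases; multiplying by it preserves the
    minimum, so the bound can be read cluster by cluster.\<close>
  define h where "h = (if \<Delta> \<le> pi / 2 then sin \<Delta> else 1)"
  have "0 \<le> h" using assms(11) by (auto simp: h_def sin_ge_zero)
  have "(\<omega>0 \<le> (if \<Delta> \<le> pi / 2 then (MIN \<alpha>\<in>{1..Nc}. f \<alpha>) * sin \<Delta> else (MIN \<alpha>\<in>{1..Nc}. f \<alpha>))) \<longleftrightarrow>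
      \<omega>0 \<le> (MIN \<alpha>\<in>{1..Nc}. f \<alpha>) * h"
    by (simp add: h_def)
  also have "\<dots> \<longleftrightarrow> (\<forall>\<alpha>\<in>{1..Nc}. \<omega>0 \<le> f \<alpha> * h)"
  proof -
    have "(MIN \<alpha>\<in>{1..Nc}. f \<alpha>) \<in> f ` {1..Nc}" using \<open>Nc \<ge> 1\<close> by (intro Min_in) auto
    moreover have "(MIN \<alpha>\<in>{1..Nc}. f \<alpha>) * h \<le> f \<alpha> * h" if "\<alpha> \<in> {1..Nc}" for \<alpha>
      using that \<open>0 \<le> h\<close> by (intro mult_right_mono Min_le) auto
    ultimately show ?thesis by (metis image_iff order_trans)
  qed
  also have "\<dots> \<longleftrightarrow> (\<forall>\<alpha>\<in>{1..Nc}. \<omega>0 / f \<alpha> \<le> 1 \<and> arcsin (\<omega>0 / f \<alpha>) \<le> \<Delta>)"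
  proof (rule ball_cong[OF refl])
    fix \<alpha> assume \<alpha>: "\<alpha> \<in> {1..Nc}"
    have "\<omega>0 \<le> f \<alpha> * h \<longleftrightarrow> \<omega>0 / f \<alpha> \<le> h" using f_pos[OF \<alpha>] by (simp add: field_simps)
    also have "\<dots> \<longleftrightarrow> \<omega>0 / f \<alpha> \<le> 1 \<and> arcsin (\<omega>0 / f \<alpha>) \<le> \<Delta>"
      unfolding h_def using f_pos[OF \<alpha>] assms(11,12) by (intro le_sin_capped_iff) auto
    finally show "\<omega>0 \<le> f \<alpha> * h \<longleftrightarrow> \<omega>0 / f \<alpha> \<le> 1 \<and> arcsin (\<omega>0 / f \<alpha>) \<le> \<Delta>" .
  qed
  finally have lag: "(\<omega>0 \<le> (if \<Delta> \<le> pi / 2 then (MIN \<alpha>\<in>{1..Nc}. f \<alpha>) * sin \<Delta>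
      else (MIN \<alpha>\<in>{1..Nc}. f \<alpha>))) \<longleftrightarrow>
      (\<forall>\<alpha>\<in>{1..Nc}. \<omega>0 / f \<alpha> \<le> 1 \<and> arcsin (\<omega>0 / f \<alpha>) \<le> \<Delta>)" .
  have total: "1 / real Nc * (2 * pi - (\<Sum>\<alpha>=1..Nc. arcsin (\<omega>0 / f \<alpha>))) > \<Delta> \<longleftrightarrow>
      (\<Sum>\<alpha>=1..Nc. arcsin (\<omega>0 / f \<alpha>) + \<Delta>) < 2 * pi"
    using \<open>Nc \<ge> 1\<close> by (auto simp: sum.distrib field_simps)
  show ?thesis
    unfolding lag total
  proof
    assume "(\<Delta>, \<omega>0) \<in> existence_domain N Iplus Iminus Nc n"
    then show "(\<forall>\<alpha>\<in>{1..Nc}. \<omega>0 / f \<alpha> \<le> 1 \<and> arcsin (\<omega>0 / f \<alpha>) \<le> \<Delta>) \<and>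
        (\<Sum>\<alpha>=1..Nc. arcsin (\<omega>0 / f \<alpha>) + \<Delta>) < 2 * pi"
      by (intro existence_domain_necessary[OF assms(3,4,8,10,7)])
  next
    assume "(\<forall>\<alpha>\<in>{1..Nc}. \<omega>0 / f \<alpha> \<le> 1 \<and> arcsin (\<omega>0 / f \<alpha>) \<le> \<Delta>) \<and>
        (\<Sum>\<alpha>=1..Nc. arcsin (\<omega>0 / f \<alpha>) + \<Delta>) < 2 * pi"
    then show "(\<Delta>, \<omega>0) \<in> existence_domain N Iplus Iminus Nc n"
      using N by (intro existence_domain_sufficient[OF assms(3,4,8,10) _ assms(7) card assms(11,12)]) auto
  qed
qed

end
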